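(* Let $n\ge1$ be an integer, let $a_1,a_2\in\mathbb{C}$ and $b_1,b_2,c_1,c_2\in\mathbb{C}\setminus\{0\}$, and let $K_n$ be the $n\times n$ pentadiagonal $2$-Toeplitz matrix and $P_{n+1}$ the polynomial defined in the context. Suppose that all zeros of $P_{n+1}$ are simple. Then the characteristic polynomial of $K_n$ is $$|xI_n-K_n|=\begin{cases}(b_1b_2)^{\frac n2}A_{n+1}(x)B_n(x), & n \text{ even},\\[4pt] b_1^{\frac{n+1}{2}}b_2^{\frac{n-1}{2}}A_n(x)B_{n+1}(x), & n\text{ odd},\end{cases}$$ where $I_n$ is the $n\times n$ identity matrix and $|\cdot|$ denotes the determinant.
   Context: The matrix $K_n=(k_{ij})_{1\le i,j\le n}$ has the following entries. For $i$ odd: $k_{ii}=a_1$, $k_{i,i+2}=b_1$ (if $i+2\le n$), $k_{i,i-2}=c_1$ (if $i-2\ge 1$). For $i$ even: $k_{ii}=a_2$, $k_{i,i+2}=b_2$ (if $i+2\le n$), $k_{i,i-2}=c_2$ (if $i-2\ge 1$). All other entries are $0$. The polynomial sequences $(A_i)_{i\ge0}$ and $(B_i)_{i\ge 0}$ in $\mathbb{C}[x]$ are defined by $A_0=0$, $A_1=1$, respectively $B_0=1$, $B_1=0$, and both sequences ($C=A$ or $C=B$) satisfy $xC_0=a_1C_0+b_1C_2$, $\;xC_1=a_2C_1+b_2C_3$, and for $i\ge3$: $xC_{i-1}=c_1C_{i-3}+a_1C_{i-1}+b_1C_{i+1}$ if $i$ is odd, $xC_{i-1}=c_2C_{i-3}+a_2C_{i-1}+b_2C_{i+1}$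 if $i$ is even. For fixed $n$, the polynomials $P_i$ ($i\ge0$) are defined by $P_i=\det\begin{bmatrix}A_n & A_i\\ B_n& B_i\end{bmatrix}=A_nB_i-A_iB_n$. *)

theory Defs
  imports Complex_Main "Jordan_Normal_Form.Char_Poly"
begin

(* K_entry numbers rows and columns from 1, the type mat from 0. *)
definition K_entry ::
  "complex \<Rightarrow> complex \<Rightarrow> complex \<Rightarrow> complex \<Rightarrow> complex \<Rightarrow> complex \<Rightarrow> nat \<Rightarrow> nat \<Rightarrow> complex" where
  "K_entry a1 a2 b1 b2 c1 c2 i j =
     (if j = i then (if odd i then a1 else a2)
      else if j = i + 2 then (if odd i then b1 else b2)
      else if i = j + 2 then (if odd i then c1 else c2)
      else 0)"

definition K_mat ::
  "complex \<Rightarrow> complex \<Rightarrow> complex \<Rightarrow> complex \<Rightarrow> complex \<Rightarrow> complex \<Rightarrow> nat \<Rightarrow> complex mat" where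
  "K_mat a1 a2 b1 b2 c1 c2 n = mat n n (\<lambda>(i, j). K_entry a1 a2 b1 b2 c1 c2 (i + 1) (j + 1))"

(* The recurrences solved for the term of largest index, with initial values u, v;
   the form with x C on the left-hand side is C_seq_recurrences below. *)
fun C_seq ::
  "complex \<Rightarrow> complex \<Rightarrow> complex \<Rightarrow> complex \<Rightarrow> complex \<Rightarrow> complex \<Rightarrow>
   complex poly \<Rightarrow> complex poly \<Rightarrow> nat \<Rightarrow> complex poly" where
  "C_seq a1 a2 b1 b2 c1 c2 u v 0 = u"
| "C_seq a1 a2 b1 b2 c1 c2 u v (Suc 0) = v"
| "C_seq a1 a2 b1 b2 c1 c2 u v (Suc (Suc 0)) = Polynomial.smult (1 / b1) ([:- a1, 1:] * u)"
| "C_seq a1 a2 b1 b2 c1 c2 u v (Suc (Suc (Suc 0))) = Polynomial.smult (1 / b2) ([:- a2, 1:] * v)"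
| "C_seq a1 a2 b1 b2 c1 c2 u v (Suc (Suc (Suc (Suc m)))) =
     (if even m
      then Polynomial.smult (1 / b1) ([:- a1, 1:] * C_seq a1 a2 b1 b2 c1 c2 u v (Suc (Suc m))
                           - Polynomial.smult c1 (C_seq a1 a2 b1 b2 c1 c2 u v m))
      else Polynomial.smult (1 / b2) ([:- a2, 1:] * C_seq a1 a2 b1 b2 c1 c2 u v (Suc (Suc m))
                           - Polynomial.smult c2 (C_seq a1 a2 b1 b2 c1 c2 u v m)))"

lemma C_seq_recurrences:
  fixes a1 a2 b1 b2 c1 c2 :: complex and u v :: "complex poly"
  assumes "b1 \<noteq> 0" "b2 \<noteq> 0"
  defines "C \<equiv> C_seq a1 a2 b1 b2 c1 c2 u v"
  shows "[:0, 1:] * C 0 = Polynomial.smult a1 (C 0) + Polynomial.smult b1 (C 2)"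
    and "[:0, 1:] * C 1 = Polynomial.smult a2 (C 1) + Polynomial.smult b2 (C 3)"
    and "\<And>i. i \<ge> 3 \<Longrightarrow> odd i \<Longrightarrow>
           [:0, 1:] * C (i - 1) = Polynomial.smult c1 (C (i - 3)) + Polynomial.smult a1 (C (i - 1))
             + Polynomial.smult b1 (C (i + 1))"
    and "\<And>i. i \<ge> 3 \<Longrightarrow> even i \<Longrightarrow>
           [:0, 1:] * C (i - 1) = Polynomial.smult c2 (C (i - 3)) + Polynomial.smult a2 (C (i - 1))
             + Polynomial.smult b2 (C (i + 1))"
proof -
  show "[:0, 1:] * C 0 = Polynomial.smult a1 (C 0) + Polynomial.smult b1 (C 2)"
    using assms by (simp add: numeral_2_eq_2)
  show "[:0, 1:] * C 1 = Polynomial.smult a2 (C 1) + Polynomial.smult b2 (C 3)"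
    using assms by (simp add: numeral_3_eq_3)
next
  fix i :: nat assume "i \<ge> 3" "odd i"
  then have "i = Suc (Suc (Suc (i - 3)))" "even (i - 3)"
    by simp_all
  then obtain m where "i = Suc (Suc (Suc m))" "even m"
    by blast
  then show "[:0, 1:] * C (i - 1) = Polynomial.smult c1 (C (i - 3)) + Polynomial.smult a1 (C (i - 1))
             + Polynomial.smult b1 (C (i + 1))"
    using assms by (simp add: numeral_3_eq_3)
next
  fix i :: nat assume "i \<ge> 3" "even i"
  then have "i = Suc (Suc (Suc (i - 3)))" "odd (i - 3)"
    by simp_all
  then obtain m where "i = Suc (Suc (Suc m))" "odd m"
    by blast
  then show "[:0, 1:] * C (i - 1) = Polynomial.smult c2 (C (i - 3)) + Polynomial.smult a2 (C (i - 1))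
             + Polynomial.smult b2 (C (i + 1))"
    using assms by (simp add: numeral_3_eq_3)
qed

definition A_poly ::
  "complex \<Rightarrow> complex \<Rightarrow> complex \<Rightarrow> complex \<Rightarrow> complex \<Rightarrow> complex \<Rightarrow> nat \<Rightarrow> complex poly" where
  "A_poly a1 a2 b1 b2 c1 c2 = C_seq a1 a2 b1 b2 c1 c2 0 1"

definition B_poly ::
  "complex \<Rightarrow> complex \<Rightarrow> complex \<Rightarrow> complex \<Rightarrow> complex \<Rightarrow> complex \<Rightarrow> nat \<Rightarrow> complex poly" where
  "B_poly a1 a2 b1 b2 c1 c2 = C_seq a1 a2 b1 b2 c1 c2 1 0"

definition P_poly ::
  "complex \<Rightarrow> complex \<Rightarrow> complex \<Rightarrow> complex \<Rightarrow> complex \<Rightarrow> complex \<Rightarrow> nat \<Rightarrow> nat \<Rightarrow> complex poly" where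
  "P_poly a1 a2 b1 b2 c1 c2 n i =
     A_poly a1 a2 b1 b2 c1 c2 n * B_poly a1 a2 b1 b2 c1 c2 i
     - A_poly a1 a2 b1 b2 c1 c2 i * B_poly a1 a2 b1 b2 c1 c2 n"

end

theory Submission
  imports Defs
begin

text \<open>
  Let \<open>M = x I - K\<close> and let \<open>V\<close> be the identity matrix with its first two columns
  replaced by \<open>(B\<^sub>0, B\<^sub>1, \<dots>)\<close> and \<open>(A\<^sub>0, A\<^sub>1, \<dots>)\<close>. Then \<open>det V = 1\<close>, and by the
  recurrences the first two columns of \<open>M V\<close> vanish except in the last two rows, while the other
  columns are those of \<open>M\<close>. So \<open>M V\<close> is block anti-triangular; one block is lower triangular with
  the entries \<open>- b\<^sub>i\<close> on its diagonal, the other is a \<open>2 \<times> 2\<close> block, and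
  \<open>det M\<close> is a multiple of \<open>B\<^sub>n A\<^sub>n\<^sub>+\<^sub>1 - B\<^sub>n\<^sub>+\<^sub>1 A\<^sub>n\<close>. The formula follows because
  \<open>A\<^sub>i = 0\<close> for even \<open>i\<close> and \<open>B\<^sub>i = 0\<close> for odd \<open>i\<close>.
\<close>

lemma det_2:
  fixes A :: "'a :: comm_ring_1 mat"
  assumes "A \<in> carrier_mat 2 2"
  shows "det A = A $$ (0, 0) * A $$ (1, 1) - A $$ (0, 1) * A $$ (1, 0)"
proof -
  have "det A = (\<Sum>j<2. A $$ (0, j) * cofactor A 0 j)"
    using laplace_expansion_row[OF assms, of 0] by simp
  also have "\<dots> = A $$ (0, 0) * cofactor A 0 0 + A $$ (0, 1) * cofactor A 0 1"
    by (simp add: numeral_2_eq_2)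
  also have "cofactor A 0 0 = A $$ (1, 1)"
    unfolding cofactor_def using assms
    by (subst det_single) (auto simp: mat_delete_def)
  also have "cofactor A 0 1 = - A $$ (1, 0)"
    unfolding cofactor_def using assms
    by (subst det_single) (auto simp: mat_delete_def)
  finally show ?thesis by simp
qed

text \<open>These are the entries of \<open>x I - K\<close>, hence the signs, with rows counted from
  0. The coefficients depend on the row arbitrarily; periodicity enters only when they are
  instantiated.\<close>

definition penta_entry ::
  "(nat \<Rightarrow> 'a) \<Rightarrow> (nat \<Rightarrow> 'a) \<Rightarrow> (nat \<Rightarrow> 'a) \<Rightarrow> nat \<Rightarrow> nat \<Rightarrow> 'a :: comm_ring_1" where
  "penta_entry p b c i j =
     (if j = i then p i else if j = i + 2 then - b i else if i = j + 2 then - c i else 0)"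

text \<open>\<open>C\<close> lies in the kernel of the infinite matrix. Keeping \<open>b i\<close>
  as a factor avoids division, so the notion makes sense over polynomials.\<close>

definition penta_solution ::
  "(nat \<Rightarrow> 'a) \<Rightarrow> (nat \<Rightarrow> 'a) \<Rightarrow> (nat \<Rightarrow> 'a) \<Rightarrow> (nat \<Rightarrow> 'a :: comm_ring_1) \<Rightarrow> bool" where
  "penta_solution p b c C \<longleftrightarrow>
     (\<forall>i. b i * C (i + 2) = p i * C i - (if 2 \<le> i then c i * C (i - 2) else 0))"

text \<open>The full row annihilates \<open>C\<close>; cutting it at \<open>n\<close> loses the term
  \<open>- b i * C (i + 2)\<close> exactly when \<open>i + 2\<close> is at least
  \<open>n\<close>.\<close>

lemma penta_row_sum:
  assumes C: "penta_solution p b c C" and i: "i < n"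
  shows "(\<Sum>k<n. penta_entry p b c i k * C k) = (if i + 2 < n then 0 else b i * C (i + 2))"
proof -
  \<comment> \<open>For \<open>i < 2\<close> the index \<open>i - 2\<close> truncates to 0, so the
    third summand carries its own guard.\<close>
  have "penta_entry p b c i k * C k =
      (if k = i then p i * C i else 0) + (if k = i + 2 then - b i * C (i + 2) else 0) +
      (if k = i - 2 then (if 2 \<le> i then - c i * C (i - 2) else 0) else 0)" for k
    by (auto simp: penta_entry_def)
  then have "(\<Sum>k<n. penta_entry p b c i k * C k) =
      p i * C i + (if i + 2 < n then - b i * C (i + 2) else 0) +
      (if 2 \<le> i then - c i * C (i - 2) else 0)"
    using i by (simp add: sum.distrib less_imp_diff_less)
  also have "\<dots> = (if i + 2 < n then 0 else b i * C (i + 2))"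
    using C[unfolded penta_solution_def, rule_format, of i] by simp
  finally show ?thesis .
qed

text \<open>Two columns can be replaced only if \<open>n\<close> is at least 2.\<close>

lemma det_penta_Suc_Suc:
  fixes p b c U W :: "nat \<Rightarrow> 'a :: idom"
  assumes U: "penta_solution p b c U" "U 0 = 1" "U 1 = 0"
    and W: "penta_solution p b c W" "W 0 = 0" "W 1 = 1"
    and n: "n = m + 2"
  shows "det (mat n n (\<lambda>(i, j). penta_entry p b c i j)) =
    (- 1) ^ n * (\<Prod>i<n. b i) * (U n * W (n + 1) - U (n + 1) * W n)"
proof -
  define M where "M = mat n n (\<lambda>(i, j). penta_entry p b c i j)"
  define V where "V = mat n n (\<lambda>(i, j).
    if j = 0 then U i else if j = 1 then W i else if i = j then 1 else 0)"
  define D where "D = mat 2 2 (\<lambda>(i, j). b (i + m) * (if j = 0 then U else W) (i + m + 2))"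
  define S where "S = mat 2 m (\<lambda>(i, j). penta_entry p b c (i + m) (j + 2))"
  define L where "L = mat m m (\<lambda>(i, j). penta_entry p b c i (j + 2))"
  have [simp]: "M \<in> carrier_mat n n" "V \<in> carrier_mat n n"
    by (simp_all add: M_def V_def)
  \<comment> \<open>The only entry above the diagonal not 0 by construction is \<open>W 0\<close>,
    which vanishes.\<close>
  have "det V = (\<Prod>i<n. V $$ (i, i))"
    by (subst det_lower_triangular[where n = n])
      (use U(3) W(2) in \<open>auto simp: V_def prod_list_diag_prod atLeast0LessThan not_less_eq less_Suc_eq\<close>)
  also have "\<dots> = 1"
    by (rule prod.neutral) (use U(2) W(3) in \<open>auto simp: V_def\<close>)
  finally have det_V: "det V = 1" .
  have MV: "(M * V) $$ (i, j) =
      (if j < 2 then if i < m then 0 else b i * (if j = 0 then U else W) (i + 2)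
       else penta_entry p b c i j)" if "i < n" "j < n" for i j
  proof -
    have "(M * V) $$ (i, j) = (\<Sum>k<n. M $$ (i, k) * V $$ (k, j))"
      using that by (simp add: M_def V_def scalar_prod_def atLeast0LessThan)
    also have "\<dots> = (\<Sum>k<n. penta_entry p b c i k *
        (if j = 0 then U k else if j = 1 then W k else if k = j then 1 else 0))"
      using that by (intro sum.cong) (auto simp: M_def V_def)
    also have "\<dots> = (if j < 2 then if i < m then 0 else b i * (if j = 0 then U else W) (i + 2)
       else penta_entry p b c i j)"
      using that penta_row_sum[OF U(1) that(1)] penta_row_sum[OF W(1) that(1)]
      by (auto simp: n if_distrib[of "\<lambda>x. _ * x"] cong: if_cong)
    finally show ?thesis .
  qed
  have shift: "Suc (Suc (j - 2)) = j" if "\<not> j < 2" for j :: nat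
    using that by simp
  have blocks: "mat (2 + m) (2 + m)
      (\<lambda>(i, j). (M * V) $$ (if i < 2 then i + m else i - 2, j)) =
      four_block_mat D S (0\<^sub>m m 2) L"
    by (rule eq_matI) (auto simp: MV n D_def S_def L_def shift)
  have det_D: "det D = b m * b (m + 1) * (U n * W (n + 1) - U (n + 1) * W n)"
    by (subst det_2) (auto simp: D_def n algebra_simps)
  have "det L = (\<Prod>i<m. - b i)"
    by (subst det_lower_triangular[where n = m])
      (auto simp: L_def penta_entry_def prod_list_diag_prod atLeast0LessThan intro!: prod.cong)
  then have det_L: "det L = (- 1) ^ m * (\<Prod>i<m. b i)"
    by (simp add: prod_uminus)
  have carrier: "M * V \<in> carrier_mat (2 + m) (2 + m)"
    by (rule carrier_matI) (simp_all add: M_def V_def n)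
  have "det M = det (M * V)"
    by (simp add: det_mult[where n = n] det_V)
  \<comment> \<open>Moving the last two rows past \<open>m\<close> others gives the sign
    \<open>(- 1) ^ (2 * m) = 1\<close>.\<close>
  also have "\<dots> = det (four_block_mat D S (0\<^sub>m m 2) L)"
    unfolding det_swap_rows[OF carrier] blocks by simp
  also have "\<dots> = det D * det L"
    by (rule det_four_block_mat_lower_left_zero) (auto simp: D_def S_def L_def)
  \<comment> \<open>The factors \<open>b m\<close> and \<open>b (m + 1)\<close> from
    \<open>D\<close> complete the product, and \<open>m\<close> and \<open>n\<close> have the same
    parity.\<close>
  finally show ?thesis
    unfolding M_def det_D det_L by (simp add: n ac_simps)
qed

lemma det_penta:
  fixes p b c U W :: "nat \<Rightarrow> 'a :: idom"
  assumes U: "penta_solution p b c U" "U 0 = 1" "U 1 = 0"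
    and W: "penta_solution p b c W" "W 0 = 0" "W 1 = 1"
  shows "det (mat n n (\<lambda>(i, j). penta_entry p b c i j)) =
    (- 1) ^ n * (\<Prod>i<n. b i) * (U n * W (n + 1) - U (n + 1) * W n)"
proof -
  consider "n = 0" | "n = 1" | m where "n = m + 2"
    by (metis One_nat_def add_2_eq_Suc' not0_implies_Suc)
  then show ?thesis
  proof cases
    case 1
    then show ?thesis using U W by simp
  next
    case 2
    then have "det (mat n n (\<lambda>(i, j). penta_entry p b c i j)) = p 0"
      by (subst det_single) (auto simp: penta_entry_def)
    moreover have "b 0 * U 2 = p 0"
      using U(1)[unfolded penta_solution_def, rule_format, of 0] U(2) by (simp add: numeral_2_eq_2)
    ultimately show ?thesis
      using 2 U(3) W(3) by (simp add: numeral_2_eq_2)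
  next
    case 3
    then show ?thesis using det_penta_Suc_Suc[OF U W] by blast
  qed
qed

text \<open>Counting from 0 swaps the parities: even \<open>i\<close> is an odd row of
  \<open>K_entry\<close> and takes the coefficients with index 1. Multiplying by \<open>b1\<close>
  or \<open>b2\<close> undoes the division in \<open>C_seq\<close>.\<close>

lemma C_seq_penta_solution:
  assumes "b1 \<noteq> 0" "b2 \<noteq> 0"
  shows "penta_solution (\<lambda>i. [:- (if even i then a1 else a2), 1:]) (\<lambda>i. [:if even i then b1 else b2:])
    (\<lambda>i. [:if even i then c1 else c2:]) (C_seq a1 a2 b1 b2 c1 c2 u v)"
  unfolding penta_solution_def
proof
  fix i :: nat
  consider "i = 0" | "i = 1" | m where "i = Suc (Suc m)"
    by (metis One_nat_def not0_implies_Suc)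
  then show "[:if even i then b1 else b2:] * C_seq a1 a2 b1 b2 c1 c2 u v (i + 2) =
      [:- (if even i then a1 else a2), 1:] * C_seq a1 a2 b1 b2 c1 c2 u v i -
      (if 2 \<le> i then [:if even i then c1 else c2:] * C_seq a1 a2 b1 b2 c1 c2 u v (i - 2) else 0)"
    using assms by cases simp_all
qed

text \<open>The recurrences link only indices of equal parity, so the initial value 0
  propagates.\<close>

lemma A_poly_even:
  assumes "even i"
  shows "A_poly a1 a2 b1 b2 c1 c2 i = 0"
proof -
  have "A_poly a1 a2 b1 b2 c1 c2 (2 * k) = 0" for k
    by (induction k rule: induct_nat_012) (simp_all add: A_poly_def numeral_2_eq_2)
  with assms show ?thesis by auto
qed

lemma B_poly_odd:
  assumes "odd i"
  shows "B_poly a1 a2 b1 b2 c1 c2 i = 0"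
proof -
  have "B_poly a1 a2 b1 b2 c1 c2 (Suc (2 * k)) = 0" for k
    by (induction k rule: induct_nat_012) (simp_all add: B_poly_def numeral_3_eq_3)
  with assms show ?thesis by (auto elim: oddE)
qed

lemma prod_alternating:
  fixes x y :: "'a :: comm_monoid_mult"
  shows "(\<Prod>i<n. if even i then x else y) = x ^ ((n + 1) div 2) * y ^ (n div 2)"
  by (induction n) (auto simp: ac_simps elim!: evenE oddE)

lemma prod_const_poly:
  fixes f :: "nat \<Rightarrow> 'a :: comm_semiring_1"
  shows "(\<Prod>i<n. [:f i:]) = [:\<Prod>i<n. f i:]"
  by (induction n) (simp_all add: mult.commute)

theorem theorem6:
  fixes a1 a2 b1 b2 c1 c2 :: complex and n :: nat
  assumes "n \<ge> 1"
    and "b1 \<noteq> 0" and "b2 \<noteq> 0" and "c1 \<noteq> 0" and "c2 \<noteq> 0"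
    and "\<forall>z. poly (P_poly a1 a2 b1 b2 c1 c2 n (n + 1)) z = 0 \<longrightarrow>
             Polynomial.order z (P_poly a1 a2 b1 b2 c1 c2 n (n + 1)) = 1"
  shows "char_poly (K_mat a1 a2 b1 b2 c1 c2 n) =
    (if even n
     then Polynomial.smult ((b1 * b2) ^ (n div 2))
            (A_poly a1 a2 b1 b2 c1 c2 (n + 1) * B_poly a1 a2 b1 b2 c1 c2 n)
     else Polynomial.smult (b1 ^ ((n + 1) div 2) * b2 ^ ((n - 1) div 2))
            (A_poly a1 a2 b1 b2 c1 c2 n * B_poly a1 a2 b1 b2 c1 c2 (n + 1)))"
proof -
  let ?p = "\<lambda>i. [:- (if even i then a1 else a2), 1:]"
    and ?b = "\<lambda>i. [:if even i then b1 else b2:]"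
    and ?c = "\<lambda>i. [:if even i then c1 else c2:]"
    and ?A = "A_poly a1 a2 b1 b2 c1 c2" and ?B = "B_poly a1 a2 b1 b2 c1 c2"
  have "char_poly_matrix (K_mat a1 a2 b1 b2 c1 c2 n) = mat n n (\<lambda>(i, j). penta_entry ?p ?b ?c i j)"
    by (rule eq_matI) (auto simp: char_poly_matrix_def K_mat_def K_entry_def penta_entry_def)
  then have "char_poly (K_mat a1 a2 b1 b2 c1 c2 n) =
      (- 1) ^ n * (\<Prod>i<n. ?b i) * (?B n * ?A (n + 1) - ?B (n + 1) * ?A n)"
    using assms(2,3) unfolding char_poly_def A_poly_def B_poly_def
    by (simp only:, intro det_penta C_seq_penta_solution) simp_all
  also have "(\<Prod>i<n. ?b i) = [:b1 ^ ((n + 1) div 2) * b2 ^ (n div 2):]"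
    by (simp add: prod_const_poly prod_alternating)
  \<comment> \<open>One of the two products vanishes by parity. For odd \<open>n\<close> the one
    left has a minus sign, which cancels \<open>(- 1) ^ n\<close>.\<close>
  finally show ?thesis
    by (cases "even n")
      (auto elim!: evenE oddE simp: A_poly_even B_poly_odd power_mult_distrib mult.commute)
qed

end
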